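(* Let $d\geq 4$ be an even integer, let $s\geq 2$, let $c_1,\dots,c_s\in\mathbb{Z}$ be distinct, and let $G=\langle x^d+c_1,\dots,x^d+c_s\rangle$ be the semigroup generated by these polynomials under composition. Assume that $f_1(x)=x^d+c_1$ is irreducible over $\mathbb{Q}$ and has a powered fixed point $y^p$ (that is, $f_1(y^p)=y^p$ with $y\in\mathbb{Q}$ and $p$ a prime dividing $d$), and that $f_2(x)=x^d+c_2$ satisfies $c_2\notin\{y^p,\,-y^p,\,-y^p-y^{pd}\}$. Then the following statements hold: (1) If $c_2\in\{0,-1\}$, then $\{f_1^3\circ f_2\circ f_1\circ g: g\in G\}$ is a set of irreducible polynomials over $\mathbb{Q}$. (2) If $c_2\notin\{0,-1\}$, then $\{f_1^3\circ f_2^3\circ g: g\in G\}$ is a set of irreducible polynomials over $\mathbb{Q}$.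
   Context: For polynomials $f_1,\dots,f_s$, $\langle f_1,\dots,f_s\rangle$ denotes the set of all finite nonempty compositions of the $f_i$ (with repetition allowed), and $f^n$ denotes the $n$-th iterate (compositional power) of $f$. *)

theory Defs
  imports "HOL-Computational_Algebra.Computational_Algebra"
begin

definition unicritical :: "nat \<Rightarrow> int \<Rightarrow> rat poly" where
  "unicritical d c = monom 1 d + [:of_int c:]"

text \<open>Finite nonempty compositions of elements of \<open>F\<close>. The identity polynomial is not
  included unless it arises as such a composition. Note that \<open>pcompose f g\<close> is \<open>f\<close> after \<open>g\<close>.\<close>

inductive_set comp_semigroup :: "'a::comm_semiring_0 poly set \<Rightarrow> 'a poly set"
  for F :: "'a poly set" where
  generator: "f \<in> F \<Longrightarrow> f \<in> comp_semigroup F"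
| compose: "g \<in> comp_semigroup F \<Longrightarrow> h \<in> comp_semigroup F \<Longrightarrow> pcompose g h \<in> comp_semigroup F"

definition comp_power :: "'a::comm_semiring_1 poly \<Rightarrow> nat \<Rightarrow> 'a poly" where
  "comp_power f n = (pcompose f ^^ n) [:0, 1:]"

end

theory Submission
  imports Defs "Jordan_Normal_Form.Char_Poly"
begin

text \<open>
  The proof rests on an irreducibility criterion and on estimates for distances between powers.

  The criterion (\<open>irreducible_pcompose_unicritical\<close>) says that a monic irreducible rational polynomial
  \<open>F\<close> of even degree stays irreducible after composition with \<open>x\<^sup>d + c\<close>, unless \<open>F(c)\<close> is a \<open>q\<close>-th power
  for some prime \<open>q\<close> dividing \<open>d\<close>. After a translation the question is about \<open>H(x\<^sup>d)\<close> and the constant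
  term \<open>H(0)\<close>, and \<open>d\<close> may be taken to be prime. A proper factor of \<open>H(x\<^sup>q)\<close> gives, through the norm of \<open>x\<^sup>q\<close>
  modulo that factor, an equation between a power of \<open>H(0)\<close> and a \<open>q\<close>-th power. The norm is computed as
  the determinant of a rational matrix.

  It follows that if no value of \<open>F\<close> at an integer is such a power, then \<open>F \<circ> g\<close> is irreducible for all
  \<open>g\<close> in the semigroup: composition with generators only restricts the set of values. It remains
  to see that the prescribed initial compositions have this property.

  Put \<open>Y = y\<^sup>p\<close>. It is an integer, being a rational root of the monic polynomial \<open>x\<^sup>d - x + c\<^sub>1\<close>, and
  \<open>c\<^sub>1 = Y - Y\<^sup>d\<close>; moreover \<open>c\<^sub>1 \<noteq> 0\<close>, since \<open>x\<^sup>d\<close> is reducible. If \<open>z\<^sup>d + c\<^sub>1\<close> is a \<open>q\<close>-th power, then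
  \<open>z\<^sup>2 \<le> \<bar>c\<^sub>1\<bar>\<close>, because distinct \<open>q\<close>-th powers are far apart. But a value \<open>z = a\<^sup>d - Y\<^sup>d + Y\<close> of \<open>f\<^sub>1\<close> is so
  large that \<open>z\<^sup>2 > \<bar>c\<^sub>1\<bar>\<close>, unless \<open>a = \<plusminus>Y\<close>. Hence the third
  iterate of \<open>f\<^sub>1\<close> takes power values at most at \<open>\<plusminus>Y\<close> (\<open>third_iterate_fixing_map_power_imp\<close>), where it does
  take the value \<open>y\<^sup>p\<close>. The polynomials composed next serve to avoid the arguments \<open>\<plusminus>Y\<close>. For \<open>c\<^sub>2\<close> not in
  \<open>{0, -1}\<close> no third iterate of an integer under \<open>f\<^sub>2\<close> equals \<open>\<plusminus>Y\<close> (\<open>third_iterate_abs_ne_power\<close>); here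
  it matters that \<open>Y\<close> is a \<open>p\<close>-th power and that \<open>c\<^sub>2 \<noteq> \<plusminus>Y - Y\<^sup>d\<close>. For \<open>c\<^sub>2\<close> in \<open>{0, -1}\<close> the critical orbit
  of \<open>f\<^sub>2\<close> is finite, and one application of \<open>f\<^sub>1\<close> makes the values large enough instead
  (\<open>abs_unicritical_fixing_map_ne\<close>).
\<close>

(* Here smult is scalar multiplication of polynomials, and irreducibility is that of the polynomial
   ring, without a translation into a condition on degrees. *)
hide_const (open) Module.module.smult

declare irreducible_connect_field [simp del]

section \<open>Multiplication modulo a polynomial\<close>

text \<open>Multiplication by \<open>P\<close> on the quotient ring of polynomials modulo \<open>A\<close>, written in the basis of the
  powers of the variable. Working with this matrix replaces computations in number fields: its
  determinant is the norm of the class of \<open>P\<close>, and its characteristic polynomial has its coefficients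
  in the ground field by construction.\<close>

definition mult_mat :: "'a::field poly \<Rightarrow> 'a poly \<Rightarrow> 'a mat" where
  "mult_mat A P = mat (degree A) (degree A) (\<lambda>(i, j). coeff ((P * monom 1 j) mod A) i)"

lemma mult_mat_carrier [simp]: "mult_mat A P \<in> carrier_mat (degree A) (degree A)"
  by (simp add: mult_mat_def)

lemma poly_sum_mod: "(sum f S) mod A = (\<Sum>i\<in>S. f i mod (A :: 'a::field poly))"
  by (induction S rule: infinite_finite_induct) (auto simp: poly_mod_add_left)

lemma mult_mat_mult_vec:
  assumes "degree R < degree A"
  shows "mult_mat A P *\<^sub>v vec (degree A) (coeff R) = vec (degree A) (coeff ((P * R) mod A))"
proof (rule eq_vecI)
  fix i assume "i < dim_vec (vec (degree A) (coeff ((P * R) mod A)))"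
  hence i: "i < degree A" by simp
  have "(\<Sum>j<degree A. monom (coeff R j) j) = R"
    using assms by (intro poly_eqI) (auto simp: coeff_sum coeff_eq_0)
  hence R: "P * R = (\<Sum>j<degree A. smult (coeff R j) (P * monom 1 j))"
    by (metis (no_types, lifting) smult_monom mult.right_neutral mult_smult_right sum.cong sum_distrib_left)
  show "(mult_mat A P *\<^sub>v vec (degree A) (coeff R)) $ i = vec (degree A) (coeff ((P * R) mod A)) $ i"
    using i by (simp add: R poly_sum_mod mod_smult_left coeff_sum mult_mat_def scalar_prod_def
        lessThan_atLeast0 mult.commute)
qed (simp add: mult_mat_def)

lemma mult_mat_mult: "mult_mat A (P * Q) = mult_mat A P * mult_mat A (Q :: 'a::field poly)"
proof (rule eq_matI)
  fix i j assume "i < dim_row (mult_mat A P * mult_mat A Q)" "j < dim_col (mult_mat A P * mult_mat A Q)"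
  hence ij: "i < degree A" "j < degree A" by (auto simp: mult_mat_def)
  let ?R = "(Q * monom 1 j) mod A"
  have d: "degree ?R < degree A" using ij degree_mod_less'[of A "Q * monom 1 j"]
    by (cases "?R = 0") (auto, metis degree_0 degree_mod_less not_less_zero)
  have col: "col (mult_mat A Q) j = vec (degree A) (coeff ?R)"
    using ij by (auto simp: mult_mat_def)
  have "(mult_mat A P * mult_mat A Q) $$ (i, j) = (mult_mat A P *\<^sub>v vec (degree A) (coeff ?R)) $ i"
    using ij col by (simp add: mult_mat_def)
  also have "\<dots> = coeff ((P * ?R) mod A) i"
    using ij by (simp add: mult_mat_mult_vec[OF d])
  also have "\<dots> = mult_mat A (P * Q) $$ (i, j)"
    using ij by (simp add: mult_mat_def mod_mult_right_eq mult.assoc)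
  finally show "mult_mat A (P * Q) $$ (i, j) = (mult_mat A P * mult_mat A Q) $$ (i, j)" by simp
qed (auto simp: mult_mat_def)

lemma mult_mat_1: "mult_mat A 1 = 1\<^sub>m (degree (A :: 'a::field poly))"
  by (rule eq_matI) (auto simp: mult_mat_def mod_poly_less degree_monom_eq)

lemma det_mult_mat_power: "det (mult_mat A (P ^ k)) = det (mult_mat A (P :: 'a::field poly)) ^ k"
  by (induction k) (auto simp: mult_mat_1 mult_mat_mult det_mult[OF mult_mat_carrier mult_mat_carrier])

text \<open>If \<open>A\<close> divides \<open>H \<circ> P\<close>, then the class of \<open>P\<close> modulo \<open>A\<close> is annihilated by \<open>H\<close>, and an eigenvalue of
  an operator annihilated by \<open>H\<close> is a root of \<open>H\<close>.\<close>

lemma root_char_poly_mult_mat: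
  fixes A H P :: "'a::field poly"
  assumes "A dvd pcompose H P" and "poly (char_poly (mult_mat A P)) l = 0"
  shows "poly H l = 0"
proof (rule ccontr)
  assume nz: "poly H l \<noteq> 0"
  from assms(2) have "eigenvalue (mult_mat A P) l"
    by (simp add: eigenvalue_root_char_poly[OF mult_mat_carrier])
  then obtain v where v: "v \<in> carrier_vec (degree A)" "v \<noteq> 0\<^sub>v (degree A)"
     "mult_mat A P *\<^sub>v v = l \<cdot>\<^sub>v v"
    unfolding eigenvalue_def eigenvector_def by (auto simp: mult_mat_def)
  \<comment> \<open>The eigenvector, read as a polynomial.\<close>
  define V where "V = (\<Sum>j<degree A. monom (v $ j) j)"
  have cV: "coeff V j = (if j < degree A then v $ j else 0)" for j
    by (auto simp: V_def coeff_sum)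
  have vV: "v = vec (degree A) (coeff V)"
    using v(1) by (intro eq_vecI) (auto simp: cV)
  have "V \<noteq> 0" using v(2) unfolding vV by (auto simp: zero_vec_def)
  have pos: "degree A > 0"
    using v(1,2) by (cases "degree A = 0") auto
  have dV: "degree V < degree A"
    by (rule le_less_trans[OF degree_le[of "degree A - 1"]]) (use pos in \<open>auto simp: cV\<close>)
  have "(P * V) mod A = smult l V"
  proof (rule poly_eqI)
    fix i
    show "coeff ((P * V) mod A) i = coeff (smult l V) i"
    proof (cases "i < degree A")
      case True
      have "vec (degree A) (coeff ((P * V) mod A)) = l \<cdot>\<^sub>v vec (degree A) (coeff V)"
        using v(3) mult_mat_mult_vec[OF dV, of P] vV by simp
      from arg_cong[OF this, of "\<lambda>x. vec_index x i"] True show ?thesis by simp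
    next
      case False
      have "degree ((P * V) mod A) < degree A"
        using pos by (metis degree_0 degree_mod_less not_less_zero)
      with False dV show ?thesis by (simp add: coeff_eq_0)
    qed
  qed
  also have "\<dots> = smult l V mod A"
    using dV by (simp add: mod_poly_less mod_smult_left)
  finally have "A dvd P * V - smult l V"
    by (simp add: mod_eq_dvd_iff)
  hence dvd1: "A dvd (P - [:l:]) * V"
    by (simp add: algebra_simps)
  \<comment> \<open>Since \<open>P\<close> acts on \<open>V\<close> as the scalar \<open>l\<close>, the polynomial \<open>H \<circ> P\<close> acts as \<open>H(l)\<close>; but it acts as zero.\<close>
  have "poly (H - [:poly H l:]) l = 0" by simp
  then obtain K where K: "H - [:poly H l:] = [:-l, 1:] * K"
    unfolding poly_eq_0_iff_dvd by (rule dvdE)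
  have "pcompose H P - [:poly H l:] = (P - [:l:]) * pcompose K P"
    using arg_cong[OF K, of "\<lambda>X. pcompose X P"]
    by (simp add: pcompose_diff pcompose_mult pcompose_pCons pcompose_smult algebra_simps)
  with dvd_mult[OF dvd1, of "pcompose K P"] have "A dvd (pcompose H P - [:poly H l:]) * V"
    by (simp only: mult_ac)
  moreover have "A dvd pcompose H P * V" using assms(1) by simp
  ultimately have "A dvd pcompose H P * V - (pcompose H P - [:poly H l:]) * V" by (rule dvd_diff[rotated])
  hence "A dvd smult (poly H l) V" by (simp add: algebra_simps)
  hence "A dvd V" using nz by (simp add: dvd_smult_iff)
  with \<open>V \<noteq> 0\<close> dV show False by (auto dest: dvd_imp_degree_le)
qed

section \<open>Characteristic polynomials over the rationals\<close>

abbreviation complex_poly :: "rat poly \<Rightarrow> complex poly" where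
  "complex_poly \<equiv> map_poly of_rat"

interpretation of_rat_poly: map_poly_inj_idom_divide_hom "of_rat :: rat \<Rightarrow> complex" ..

lemma complex_root_ex:
  assumes "degree (N :: rat poly) > 0"
  shows "\<exists>z. poly (complex_poly N) z = 0"
  using assms by (intro fundamental_theorem_of_algebra) (simp add: constant_degree)

text \<open>Both polynomials are multiples of the minimal polynomial \<open>R\<close> of the common root, and \<open>H\<close>, being
  irreducible, is associated to \<open>R\<close>.\<close>

lemma irreducible_dvd_of_common_root:
  fixes H N :: "rat poly"
  assumes "irreducible H" "poly (complex_poly H) z = 0" "poly (complex_poly N) z = 0"
  shows "H dvd N"
proof -
  define S where "S = {R :: rat poly. R \<noteq> 0 \<and> poly (complex_poly R) z = 0}"
  have "H \<in> S" using assms(1,2) by (auto simp: S_def irreducible_def)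
  then obtain R where R: "R \<in> S" and least: "\<And>T. T \<in> S \<Longrightarrow> degree R \<le> degree T"
    using ex_has_least_nat[of "\<lambda>R. R \<in> S" H degree] by blast
  have R0: "R \<noteq> 0" and Rz: "poly (complex_poly R) z = 0" using R by (auto simp: S_def)
  have dvd: "R dvd T" if "poly (complex_poly T) z = 0" for T
  proof -
    have "poly (complex_poly (T div R * R + T mod R)) z = 0"
      using that by simp
    hence "poly (complex_poly (T mod R)) z = 0"
      unfolding of_rat_poly.hom_add of_rat_poly.hom_mult using Rz by simp
    hence "T mod R \<noteq> 0 \<Longrightarrow> degree R \<le> degree (T mod R)"
      using least by (simp add: S_def)
    hence "T mod R = 0"
      using degree_mod_less[OF R0, of T] by fastforce
    thus ?thesis by auto
  qed
  from dvd[OF assms(2)] obtain C where C: "H = R * C" by (elim dvdE)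
  have "\<not> is_unit R"
  proof
    assume "is_unit R"
    then obtain U where "R * U = 1" by (auto simp: dvd_def)
    from arg_cong[OF this, of "\<lambda>X. poly (complex_poly X) z"] Rz show False
      unfolding of_rat_poly.hom_mult by simp
  qed
  with irreducibleD[OF assms(1) C] have "is_unit C" by blast
  hence "H dvd R" by (simp add: C)
  also have "R dvd N" by (rule dvd[OF assms(3)])
  finally show ?thesis .
qed

lemma eq_power_of_irreducible:
  fixes H N :: "rat poly"
  assumes "irreducible H" "lead_coeff H = 1" "lead_coeff N = 1"
    and "\<And>z. poly (complex_poly N) z = 0 \<Longrightarrow> poly (complex_poly H) z = 0"
  shows "\<exists>k. N = H ^ k"
  using assms(3,4)
proof (induction "degree N" arbitrary: N rule: less_induct)
  case less
  have dH: "degree H > 0"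
    using assms(1) by (auto simp: irreducible_def is_unit_iff_degree)
  show ?case
  proof (cases "degree N = 0")
    case True
    then obtain a where "N = [:a:]" by (elim degree_eq_zeroE)
    with less.prems(1) have "N = 1" by (simp add: one_pCons)
    thus ?thesis by (intro exI[of _ 0]) simp
  next
    case False
    then obtain z where "poly (complex_poly N) z = 0"
      using complex_root_ex by blast
    with less.prems(2) have "H dvd N"
      using irreducible_dvd_of_common_root[OF assms(1)] by blast
    then obtain M where M: "N = H * M" by (elim dvdE)
    have "M \<noteq> 0" "H \<noteq> 0" using less.prems(1) M by auto
    hence "degree M < degree N" using dH by (simp add: M degree_mult_eq)
    moreover have "lead_coeff M = 1"
      using less.prems(1) assms(2) by (simp add: M lead_coeff_mult)
    moreover have "poly (complex_poly H) z = 0" if "poly (complex_poly M) z = 0" for z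
      using that less.prems(2)[of z] by (simp add: M hom_distribs)
    ultimately obtain k where "M = H ^ k" using less.hyps by blast
    thus ?thesis by (intro exI[of _ "Suc k"]) (simp add: M)
  qed
qed

lemma complex_poly_pcompose:
  "complex_poly (pcompose P Q) = pcompose (complex_poly P) (complex_poly Q)"
  by (simp add: of_rat_hom.map_poly_pcompose)

lemma complex_poly_mod: "complex_poly (P mod Q) = complex_poly P mod complex_poly Q"
  by (simp add: of_rat_hom.map_poly_mod)

lemma map_mat_mult_mat:
  "map_mat of_rat (mult_mat A P) = mult_mat (complex_poly A) (complex_poly P)"
proof -
  have "of_rat (coeff ((P * monom 1 j) mod A) i) =
      coeff ((complex_poly P * monom 1 j) mod complex_poly A) i" for i j
    unfolding of_rat_hom.coeff_map_poly_hom[symmetric] complex_poly_mod of_rat_poly.hom_mult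
    by simp
  thus ?thesis
    by (intro eq_matI) (simp_all add: mult_mat_def)
qed

text \<open>All complex roots of the characteristic polynomial are roots of the irreducible \<open>H\<close>, so \<open>H\<close> is its
  only irreducible factor over the rationals.\<close>

lemma char_poly_mult_mat_eq_power:
  fixes A H P :: "rat poly"
  assumes "irreducible H" "lead_coeff H = 1" "A dvd pcompose H P"
  shows "\<exists>k. char_poly (mult_mat A P) = H ^ k"
proof (rule eq_power_of_irreducible[OF assms(1,2)])
  show "lead_coeff (char_poly (mult_mat A P)) = 1"
    using degree_monic_char_poly[OF mult_mat_carrier[of A P]] by auto
next
  fix z assume "poly (complex_poly (char_poly (mult_mat A P))) z = 0"
  hence eigenvalue: "poly (char_poly (mult_mat (complex_poly A) (complex_poly P))) z = 0"
    by (simp add: of_rat_hom.char_poly_hom[OF mult_mat_carrier, symmetric] map_mat_mult_mat)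
  have "complex_poly A dvd complex_poly (pcompose H P)"
    using assms(3) by (rule of_rat_poly.hom_dvd)
  hence "complex_poly A dvd pcompose (complex_poly H) (complex_poly P)"
    by (simp only: complex_poly_pcompose)
  thus "poly (complex_poly H) z = 0"
    using eigenvalue by (rule root_char_poly_mult_mat)
qed

lemma coeff_0_char_poly:
  fixes M :: "'a::field mat"
  assumes "M \<in> carrier_mat n n"
  shows "coeff (char_poly M) 0 = (-1) ^ n * det M"
proof -
  have "coeff (char_poly M) 0 = det (map_mat (\<lambda>X. poly X 0) (char_poly_matrix M))"
    by (simp add: poly_0_coeff_0[symmetric] char_poly_def comm_ring_hom.hom_det[OF poly_hom.comm_ring_hom_axioms])
  also have "map_mat (\<lambda>X. poly X 0) (char_poly_matrix M) = (-1) \<cdot>\<^sub>m M"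
    using assms by (intro eq_matI) (auto simp: char_poly_matrix_def)
  also have "det \<dots> = (-1) ^ n * det M"
    using assms by simp
  finally show ?thesis .
qed

lemma power_eq_power_imp_power:
  fixes x m :: "'a::field"
  assumes "x ^ k = m ^ q" "coprime k q" "k > 0" "x \<noteq> 0"
  shows "\<exists>w. x = w ^ q"
proof -
  obtain u v where uv: "k * u = q * v + 1"
    using bezout_nat[of k q] assms(2,3) by auto
  have "(m ^ u) ^ q = (x ^ k) ^ u"
    unfolding assms(1) by (simp only: mult.commute flip: power_mult)
  also have "\<dots> = x ^ (v * q + 1)"
    by (simp only: uv mult.commute flip: power_mult)
  also have "\<dots> = (x ^ v) ^ q * x"
    by (simp only: power_add power_mult power_one_right)
  finally have "(m ^ u) ^ q = (x ^ v) ^ q * x" .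
  hence "x = (m ^ u / x ^ v) ^ q"
    using assms(4) by (simp add: power_divide field_simps)
  thus ?thesis by blast
qed

section \<open>Irreducibility of compositions with unicritical polynomials\<close>

text \<open>This is a form of Capelli's criterion. Let \<open>A\<close> be a proper factor of \<open>H(x\<^sup>q)\<close>, and consider
  multiplication by \<open>x\<^sup>q\<close> modulo \<open>A\<close>. Its characteristic polynomial is \<open>H\<^sup>k\<close>, where the degree of \<open>A\<close>
  is \<open>k\<close> times that of \<open>H\<close>, so that \<open>0 < k < q\<close>. Its determinant is the \<open>q\<close>-th power of the
  determinant of multiplication by \<open>x\<close>. Comparing constant terms, \<open>H(0)\<^sup>k\<close> is a \<open>q\<close>-th power, and
  since \<open>k\<close> is prime to \<open>q\<close>, so is \<open>H(0)\<close>. The even degree of \<open>H\<close> removes the sign between the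
  determinant and the constant term.\<close>

lemma irreducible_pcompose_prime_monom:
  fixes H :: "rat poly"
  assumes "irreducible H" "lead_coeff H = 1" "even (degree H)" "prime q"
    and nonpower: "\<And>w. coeff H 0 \<noteq> w ^ q"
  shows "irreducible (pcompose H (monom 1 q))"
proof (rule ccontr)
  let ?X = "monom 1 1 :: rat poly" and ?F = "pcompose H (monom 1 q)"
  have q: "q > 1" using assms(4) prime_gt_1_nat by blast
  have dH: "degree H > 0"
    using assms(1) by (auto simp: irreducible_def is_unit_iff_degree)
  have dF: "degree ?F = degree H * q"
    by (simp add: degree_pcompose degree_monom_eq)
  assume "\<not> irreducible ?F"
  moreover have "degree ?F \<noteq> 0" using dF dH q by simp
  hence "?F \<noteq> 0" "\<not> is_unit ?F" by (metis degree_0, metis degree_0 is_unit_iff_degree)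
  ultimately obtain A B where "?F = A * B" "\<not> is_unit A" "\<not> is_unit B"
    unfolding irreducible_def by blast
  with \<open>?F \<noteq> 0\<close> have AB: "?F = A * B" "degree A > 0" "degree B > 0"
    by (auto simp: is_unit_iff_degree)
  have nz: "A \<noteq> 0" "B \<noteq> 0" using AB by auto
  have dA: "degree A < degree H * q"
    using AB nz dF by (metis degree_mult_eq less_add_same_cancel1)
  obtain k where k: "char_poly (mult_mat A (monom 1 q)) = H ^ k"
    using char_poly_mult_mat_eq_power[OF assms(1,2), of A "monom 1 q"] AB(1) by auto
  have "degree (char_poly (mult_mat A (monom 1 q))) = degree A"
    using degree_monic_char_poly[OF mult_mat_carrier] by blast
  hence dAk: "degree A = k * degree H"
    using dH by (subst (asm) k, subst (asm) degree_power_eq) (auto simp: mult.commute)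
  with dA AB(2) dH have "k > 0" "k < q" by auto
  hence cop: "coprime k q"
    using assms(4) by (meson coprime_commute nat_dvd_not_less prime_imp_coprime)
  have "coeff H 0 ^ k = coeff (char_poly (mult_mat A (monom 1 q))) 0"
    by (simp add: k coeff_0_power)
  also have "\<dots> = (-1) ^ degree A * det (mult_mat A (monom 1 q))"
    by (rule coeff_0_char_poly) simp
  also have "\<dots> = det (mult_mat A (?X ^ q))"
    using assms(3) dAk by (simp add: monom_power)
  also have "\<dots> = det (mult_mat A ?X) ^ q"
    by (rule det_mult_mat_power)
  finally have eq: "coeff H 0 ^ k = det (mult_mat A ?X) ^ q" .
  have "coeff H 0 \<noteq> 0"
    using nonpower[of 0] q by (simp add: power_0_left)
  then obtain w where "coeff H 0 = w ^ q"
    using power_eq_power_imp_power[OF eq cop \<open>k > 0\<close>] by blast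
  with nonpower show False by blast
qed

text \<open>The exponent \<open>d\<close> can be built up one prime at a time, because replacing \<open>x\<close> by \<open>x\<^sup>q\<close> changes neither
  the constant term nor the evenness of the degree.\<close>

lemma irreducible_pcompose_monom:
  fixes H :: "rat poly"
  assumes "irreducible H" "lead_coeff H = 1" "even (degree H)" "d > 0"
    and "\<And>q w. prime q \<Longrightarrow> q dvd d \<Longrightarrow> coeff H 0 \<noteq> w ^ q"
  shows "irreducible (pcompose H (monom 1 d))"
  using assms
proof (induction d arbitrary: H rule: less_induct)
  case (less d)
  show ?case
  proof (cases "d = 1")
    case True
    thus ?thesis using less.prems by (simp add: monom_altdef)
  next
    case False
    then obtain q e where q: "prime q" "d = q * e"
      using less.prems(4) by (metis dvdE prime_factor_nat)
    have q1: "q > 1" using q(1) prime_gt_1_nat by blast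
    define K where "K = pcompose H (monom 1 q)"
    have c0: "coeff K 0 = coeff H 0"
      using q1 by (simp add: K_def poly_0_coeff_0[symmetric] poly_pcompose poly_monom power_0_left)
    have "irreducible K"
      unfolding K_def using less.prems q by (intro irreducible_pcompose_prime_monom) auto
    moreover have "lead_coeff K = 1"
      unfolding K_def using less.prems(2) q1
      by (subst lead_coeff_comp) (auto simp: degree_monom_eq)
    moreover have "even (degree K)"
      using less.prems(3) by (simp add: K_def degree_pcompose)
    moreover have "e < d" "e > 0"
      using q q1 less.prems(4) by auto
    ultimately have "irreducible (pcompose K (monom 1 e))"
      using less.IH[of e K] less.prems(5) q(2) c0 by auto
    also have "pcompose K (monom 1 e) = pcompose H (monom 1 d)"
      by (simp add: K_def pcompose_assoc[symmetric] q(2) monom_altdef pcompose_hom.hom_power power_mult[symmetric] mult.commute)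
    finally show ?thesis .
  qed
qed

lemma irreducible_pcompose_translation:
  fixes F :: "'a::field poly"
  assumes "irreducible F"
  shows "irreducible (pcompose F [:c, 1:])"
proof (rule irreducibleI)
  have inv: "pcompose (pcompose P [:c, 1:]) [:-c, 1:] = P" "pcompose (pcompose P [:-c, 1:]) [:c, 1:] = P"
    for P :: "'a poly"
    by (simp_all add: pcompose_assoc[symmetric] pcompose_pCons)
  show "pcompose F [:c, 1:] \<noteq> 0"
    using inv(1)[of F] assms by auto
  show "\<not> is_unit (pcompose F [:c, 1:])"
    using assms by (auto simp: is_unit_iff_degree irreducible_def degree_pcompose pcompose_eq_0_iff)
  fix P Q assume "pcompose F [:c, 1:] = P * Q"
  hence "F = pcompose P [:-c, 1:] * pcompose Q [:-c, 1:]"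
    using inv(1)[of F] by (simp add: pcompose_mult)
  with assms have "is_unit (pcompose P [:-c, 1:]) \<or> is_unit (pcompose Q [:-c, 1:])"
    by (rule irreducibleD)
  thus "is_unit P \<or> is_unit Q"
    by (auto simp: is_unit_iff_degree degree_pcompose pcompose_eq_0_iff)
qed

lemma irreducible_pcompose_unicritical:
  fixes F :: "rat poly"
  assumes "irreducible F" "lead_coeff F = 1" "even (degree F)" "d > 0"
    and "\<And>q w. prime q \<Longrightarrow> q dvd d \<Longrightarrow> poly F (of_int c) \<noteq> w ^ q"
  shows "irreducible (pcompose F (unicritical d c))"
proof -
  have "irreducible (pcompose (pcompose F [:of_int c, 1:]) (monom 1 d))"
  proof (rule irreducible_pcompose_monom)
    show "irreducible (pcompose F [:of_int c, 1:])"
      by (rule irreducible_pcompose_translation[OF assms(1)])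
    show "lead_coeff (pcompose F [:of_int c, 1:]) = 1"
      using assms(2) by (subst lead_coeff_comp) auto
    show "even (degree (pcompose F [:of_int c, 1:]))"
      using assms(3) by (simp add: degree_pcompose)
    show "coeff (pcompose F [:of_int c, 1:]) 0 \<noteq> w ^ q" if "prime q" "q dvd d" for q w
      using assms(5)[OF that] by (simp add: poly_0_coeff_0[symmetric] poly_pcompose)
  qed (use assms in auto)
  also have "pcompose (pcompose F [:of_int c, 1:]) (monom 1 d) = pcompose F (unicritical d c)"
    by (simp add: pcompose_assoc[symmetric] pcompose_pCons unicritical_def add.commute)
  finally show ?thesis .
qed

definition unicritical_map :: "nat \<Rightarrow> int \<Rightarrow> int \<Rightarrow> int" where
  "unicritical_map d c x = x ^ d + c"

lemma unicritical_simps: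
  assumes "d > 0"
  shows degree_unicritical: "degree (unicritical d c) = d"
    and lead_coeff_unicritical: "lead_coeff (unicritical d c) = 1"
proof -
  show "degree (unicritical d c) = d"
    unfolding unicritical_def using assms
    by (subst degree_add_eq_left) (auto simp: degree_monom_eq)
  thus "lead_coeff (unicritical d c) = 1"
    using assms by (simp add: unicritical_def coeff_pCons split: nat.splits)
qed

lemma poly_unicritical_of_int: "poly (unicritical d c) (of_int a) = of_int (unicritical_map d c a)"
  by (simp add: unicritical_def unicritical_map_def poly_monom)

definition even_monic_irreducible :: "rat poly \<Rightarrow> bool" where
  "even_monic_irreducible F \<longleftrightarrow> irreducible F \<and> lead_coeff F = 1 \<and> even (degree F)"

lemma even_monic_irreducible_pcompose_unicritical:
  assumes "even_monic_irreducible F" "d > 0"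
    and "\<And>q w. prime q \<Longrightarrow> q dvd d \<Longrightarrow> poly F (of_int c) \<noteq> w ^ q"
  shows "even_monic_irreducible (pcompose F (unicritical d c))"
proof -
  have "irreducible (pcompose F (unicritical d c))"
    using assms by (intro irreducible_pcompose_unicritical) (auto simp: even_monic_irreducible_def)
  moreover have "lead_coeff (pcompose F (unicritical d c)) = 1"
    using lead_coeff_comp[of "unicritical d c" F] lead_coeff_unicritical[OF assms(2)] assms(1,2)
    unfolding even_monic_irreducible_def by (simp only: degree_unicritical power_one mult_1)
  ultimately show ?thesis
    using assms(1) by (auto simp: even_monic_irreducible_def degree_pcompose)
qed

text \<open>A value of \<open>F \<circ> f\<close> at an integer is a value of \<open>F\<close> at another integer. So a polynomial \<open>F\<close> without
  power values at integers keeps this property, and with it the irreducibility, when the generators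
  are composed to its right one after the other.\<close>

lemma even_monic_irreducible_pcompose_semigroup:
  assumes "g \<in> comp_semigroup (unicritical d ` C)" "d > 0" "even_monic_irreducible F"
    and "\<And>q w a. prime q \<Longrightarrow> q dvd d \<Longrightarrow> poly F (of_int a) \<noteq> w ^ q"
  shows "even_monic_irreducible (pcompose F g) \<and>
    (\<forall>q w a. prime q \<longrightarrow> q dvd d \<longrightarrow> poly (pcompose F g) (of_int a) \<noteq> w ^ q)"
  using assms
proof (induction g arbitrary: F rule: comp_semigroup.induct)
  case (generator f)
  then obtain c where f: "f = unicritical d c" by blast
  show ?case
    unfolding f using generator.prems
    by (auto intro!: even_monic_irreducible_pcompose_unicritical simp: poly_pcompose poly_unicritical_of_int)
next
  case (compose g h)
  have "even_monic_irreducible (pcompose F g) \<and>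
    (\<forall>q w a. prime q \<longrightarrow> q dvd d \<longrightarrow> poly (pcompose F g) (of_int a) \<noteq> w ^ q)"
    using compose.prems by (intro compose.IH(1)) auto
  hence "even_monic_irreducible (pcompose (pcompose F g) h) \<and>
    (\<forall>q w a. prime q \<longrightarrow> q dvd d \<longrightarrow> poly (pcompose (pcompose F g) h) (of_int a) \<noteq> w ^ q)"
    using compose.prems by (intro compose.IH(2)) auto
  thus ?case by (simp add: pcompose_assoc)
qed

section \<open>Distances between powers of integers\<close>

lemma power_Suc_diff_ge:
  fixes a b :: int
  assumes "0 \<le> b" "b < a"
  shows "a ^ n \<le> a ^ Suc n - b ^ Suc n" "b ^ n \<le> a ^ Suc n - b ^ Suc n"
proof -
  have le: "b ^ n \<le> a ^ n" using assms by (intro power_mono) auto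
  have "a ^ n \<le> (a - b) * a ^ n"
    using assms by (intro mult_le_cancel_right1[THEN iffD2]) auto
  also have "\<dots> \<le> a ^ Suc n - b ^ Suc n"
    using mult_left_mono[OF le assms(1)] by (simp add: algebra_simps)
  finally show "a ^ n \<le> a ^ Suc n - b ^ Suc n" .
  with le show "b ^ n \<le> a ^ Suc n - b ^ Suc n" by linarith
qed

lemma abs_power_diff_ge:
  fixes a b :: int
  assumes "\<bar>a\<bar> \<noteq> \<bar>b\<bar>" "n > 0"
  shows "\<bar>a\<bar> ^ (n - 1) \<le> \<bar>\<bar>a\<bar> ^ n - \<bar>b\<bar> ^ n\<bar>"
proof -
  obtain m where n: "n = Suc m" using assms(2) by (cases n) auto
  show ?thesis
    using assms(1) power_Suc_diff_ge[of "\<bar>b\<bar>" "\<bar>a\<bar>" m] power_Suc_diff_ge[of "\<bar>a\<bar>" "\<bar>b\<bar>" m]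
    unfolding n by (cases "\<bar>a\<bar> < \<bar>b\<bar>") (simp_all del: power_Suc)
qed

lemma power_gap:
  fixes u w x :: int
  assumes "\<bar>x\<bar> = \<bar>w\<bar> ^ q" "u ^ q \<noteq> x" "q > 0"
  shows "\<bar>u\<bar> ^ (q - 1) \<le> \<bar>u ^ q - x\<bar>"
proof (cases "\<bar>u\<bar> = \<bar>w\<bar>")
  case False
  have "\<bar>u\<bar> ^ (q - 1) \<le> \<bar>\<bar>u ^ q\<bar> - \<bar>x\<bar>\<bar>"
    using abs_power_diff_ge[OF False assms(3)] by (simp add: assms(1) power_abs)
  thus ?thesis by linarith
next
  case True
  hence "\<bar>x\<bar> = \<bar>u ^ q\<bar>" by (simp add: assms(1) power_abs)
  with assms(2) have x: "x = - (u ^ q)" by linarith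
  with assms(2,3) have "u \<noteq> 0" by auto
  hence "\<bar>u\<bar> ^ (q - 1) \<le> \<bar>u\<bar> ^ q"
    by (intro power_increasing) auto
  also have "\<dots> \<le> \<bar>u ^ q - x\<bar>"
    by (simp add: x power_abs[symmetric])
  finally show ?thesis .
qed

text \<open>Distinct \<open>q\<close>-th powers differ at least by the \<open>(q - 1)\<close>-st power of the size of either base. For \<open>z\<^sup>d\<close>, a
  \<open>q\<close>-th power of \<open>z\<^bsup>d/q\<^esup>\<close>, this gives at least the power of \<open>\<bar>z\<bar>\<close> with exponent \<open>(d/q) (q - 1) \<ge> 2\<close>. Only the
  size of \<open>x\<close> is prescribed, so that both \<open>w\<^sup>q\<close> and \<open>-w\<^sup>q\<close> are covered.\<close>

lemma power_gap_square:
  fixes z w x :: int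
  assumes "d \<ge> 4" "prime q" "q dvd d" "\<bar>x\<bar> = \<bar>w\<bar> ^ q" "z ^ d \<noteq> x"
  shows "z\<^sup>2 \<le> \<bar>z ^ d - x\<bar>"
proof (cases "z = 0")
  case False
  obtain e where e: "d = e * q" using assms(3) by (metis dvdE mult.commute)
  have q: "q \<ge> 2" using assms(2) prime_ge_2_nat by blast
  have "2 \<le> e * (q - 1)"
  proof (cases "e \<ge> 2")
    case True
    thus ?thesis using mult_le_mono[of 2 e 1 "q - 1"] q by simp
  next
    case False
    hence "e = 1" using e assms(1) by (cases e) auto
    thus ?thesis using e assms(1) by simp
  qed
  hence "\<bar>z\<bar> ^ 2 \<le> \<bar>z\<bar> ^ (e * (q - 1))"
    using False by (intro power_increasing) auto
  also have "\<dots> = \<bar>z ^ e\<bar> ^ (q - 1)"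
    by (simp add: power_mult power_abs)
  also have "\<dots> \<le> \<bar>(z ^ e) ^ q - x\<bar>"
    using assms q by (intro power_gap[of x w q]) (auto simp: e power_mult)
  finally show ?thesis by (simp add: e power_mult)
qed auto

text \<open>Two distinct \<open>d\<close>-th powers, one of them with base \<open>t\<close>, differ by at least \<open>t\<^bsup>d-1\<^esup>\<close>, and \<open>B\<close> stands for
  the size of such a difference up to an error \<open>t\<close>. The two bounds are made to contradict the upper
  bounds for \<open>B\<^sup>2\<close> that come from the distance between powers.\<close>

lemma square_growth:
  fixes t B :: int
  assumes "t \<ge> 2" "d \<ge> 4" "t ^ (d - 1) - t \<le> B"
  shows "t ^ d + t < B\<^sup>2" "t ^ d + B < B\<^sup>2"
proof -
  define T where "T = t ^ (d - 2)"
  have td: "t ^ d = t\<^sup>2 * T" and td1: "t ^ (d - 1) = t * T"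
    using assms(2) unfolding T_def
    by (simp_all only: power_add[symmetric] power_Suc[symmetric]) (rule arg_cong[where f = "(^) t"], simp)+
  have "2 ^ 2 \<le> t ^ 2" using assms(1) by (intro power_mono) auto
  also have "t ^ 2 \<le> T"
    unfolding T_def using assms(1,2) by (intro power_increasing) auto
  finally have T: "T \<ge> 4" by simp
  have B: "t * (T - 1) \<le> B" using assms(3) unfolding td1 by (simp add: algebra_simps)
  have "2 * 3 \<le> t * (T - 1)" using assms(1) T by (intro mult_mono) auto
  hence six: "6 \<le> t * (T - 1)" by simp
  have "4 * T \<le> T * T" using T by simp
  hence sq: "2 * T + 1 \<le> (T - 1)\<^sup>2" by (simp add: power2_eq_square algebra_simps)
  have tt: "2 * t \<le> t\<^sup>2" using assms(1) by (simp add: power2_eq_square)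
  have "t\<^sup>2 * (2 * T + 1) \<le> t\<^sup>2 * (T - 1)\<^sup>2" using sq by (intro mult_left_mono) auto
  also have "\<dots> = (t * (T - 1))\<^sup>2" by (simp add: power_mult_distrib)
  finally have main: "2 * (t\<^sup>2 * T) + t\<^sup>2 \<le> (t * (T - 1))\<^sup>2" by (simp add: algebra_simps)
  have tT: "2 * t * T \<le> t\<^sup>2 * T" using mult_right_mono[OF tt, of T] T by simp
  have p: "0 \<le> t\<^sup>2 * T" using T by simp
  have pos: "t * T \<ge> 0" using assms(1) T by simp
  have "(t * (T - 1))\<^sup>2 \<le> B\<^sup>2" using B six by (intro power_mono) auto
  thus "t ^ d + t < B\<^sup>2" using main tt assms(1) p unfolding td by linarith
  have "(t * (T - 1)) * (t * (T - 1) - 1) \<le> B * (B - 1)"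
    using B six by (intro mult_mono) auto
  hence "(t * (T - 1))\<^sup>2 - t * (T - 1) \<le> B\<^sup>2 - B"
    by (simp add: power2_eq_square algebra_simps)
  thus "t ^ d + B < B\<^sup>2" using main tT tt assms(1) pos unfolding td
    by (simp add: algebra_simps)
qed

text \<open>The unicritical map of degree \<open>d\<close> that fixes \<open>Y\<close>.\<close>

abbreviation fixing_map :: "nat \<Rightarrow> int \<Rightarrow> int \<Rightarrow> int" where
  "fixing_map d Y \<equiv> unicritical_map d (Y - Y ^ d)"

lemma abs_even_power_diff_ge:
  fixes a b :: int
  assumes "\<bar>a\<bar> \<noteq> \<bar>b\<bar>" "even d" "d > 0"
  shows "max \<bar>a\<bar> \<bar>b\<bar> ^ (d - 1) \<le> \<bar>a ^ d - b ^ d\<bar>"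
  using abs_power_diff_ge[OF assms(1,3)] abs_power_diff_ge[OF assms(1)[symmetric] assms(3)] assms(2)
  by (cases "\<bar>a\<bar> \<le> \<bar>b\<bar>") (auto simp: max_def power_even_abs abs_minus_commute)

context
  fixes d :: nat and Y :: int
  assumes d: "d \<ge> 4" "even d" and Y: "Y \<noteq> 0" "Y \<noteq> 1"
begin

text \<open>The value at \<open>a\<close> is \<open>a\<^sup>d - Y\<^sup>d + Y\<close>, which is large as soon as \<open>a\<^sup>d\<close> and \<open>Y\<^sup>d\<close> differ.\<close>

lemma square_fixing_map_gt:
  assumes "\<bar>a\<bar> \<noteq> \<bar>Y\<bar>"
  shows "\<bar>Y\<bar> ^ d + \<bar>Y\<bar> < (fixing_map d Y a)\<^sup>2"
proof -
  define t where "t = max \<bar>a\<bar> \<bar>Y\<bar>"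
  have gap: "t ^ (d - 1) \<le> \<bar>a ^ d - Y ^ d\<bar>"
    unfolding t_def by (rule abs_even_power_diff_ge) (use assms d in auto)
  have Yt: "\<bar>Y\<bar> \<le> t" by (simp add: t_def)
  show ?thesis
  proof (cases "t \<ge> 2")
    case True
    have "t ^ (d - 1) - t \<le> \<bar>fixing_map d Y a\<bar>"
      using gap Yt by (simp add: unicritical_map_def)
    hence "t ^ d + t < \<bar>fixing_map d Y a\<bar>\<^sup>2" using True d by (intro square_growth)
    moreover have "\<bar>Y\<bar> ^ d \<le> t ^ d" using Yt by (intro power_mono) auto
    ultimately show ?thesis using Yt by simp
  next
    case False
    \<comment> \<open>The only remaining case; the map is then \<open>x\<^sup>d - 2\<close>, with value \<open>-2\<close>.\<close>
    hence "Y = -1" "a = 0" using Y assms by (auto simp: t_def)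
    thus ?thesis using d by (simp add: unicritical_map_def power_0_left)
  qed
qed

text \<open>If \<open>z\<^sup>d - (Y\<^sup>d - Y)\<close> is a \<open>q\<close>-th power, then \<open>z\<^sup>2 \<le> \<bar>Y\<^sup>d - Y\<bar>\<close> by the distance between powers. For
  \<open>z\<close> itself a value of the map this contradicts the lower bound above.\<close>

lemma second_iterate_fixing_map_not_power:
  assumes "\<bar>a\<bar> \<noteq> \<bar>Y\<bar>" "prime q" "q dvd d"
  shows "fixing_map d Y (fixing_map d Y a) \<noteq> w ^ q"
proof
  assume eq: "fixing_map d Y (fixing_map d Y a) = w ^ q"
  have "Y ^ d \<noteq> Y"
  proof
    assume "Y ^ d = Y"
    moreover have "Y ^ d = Y * Y ^ (d - 1)" using d by (simp flip: power_Suc)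
    ultimately have "Y ^ (d - 1) = 1" using Y(1) by simp
    hence "\<bar>Y\<bar> ^ (d - 1) = 1 ^ (d - 1)" by (simp flip: power_abs)
    hence "\<bar>Y\<bar> = 1" using d by (subst (asm) power_eq_iff_eq_base) auto
    hence "Y = -1" using Y by auto
    thus False using \<open>Y ^ d = Y\<close> d by simp
  qed
  with eq have "fixing_map d Y a ^ d \<noteq> w ^ q" by (auto simp: unicritical_map_def)
  hence "(fixing_map d Y a)\<^sup>2 \<le> \<bar>fixing_map d Y a ^ d - w ^ q\<bar>"
    by (intro power_gap_square[of d q _ w]) (use assms d in \<open>auto simp: power_abs\<close>)
  also have "\<dots> = \<bar>Y ^ d - Y\<bar>" using eq by (simp add: unicritical_map_def)
  also have "\<dots> \<le> \<bar>Y\<bar> ^ d + \<bar>Y\<bar>" unfolding power_abs[symmetric] by linarith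
  finally show False using square_fixing_map_gt[OF assms(1)] by simp
qed

lemma abs_eq_if_fixing_map_abs_eq:
  assumes "\<bar>fixing_map d Y a\<bar> = \<bar>Y\<bar>"
  shows "\<bar>a\<bar> = \<bar>Y\<bar>"
proof (rule ccontr)
  assume "\<bar>a\<bar> \<noteq> \<bar>Y\<bar>"
  hence "\<bar>Y\<bar> ^ d < \<bar>Y\<bar> ^ 2"
    using square_fixing_map_gt[of a] power2_abs[of "fixing_map d Y a"] unfolding assms by linarith
  moreover have "\<bar>Y\<bar> ^ 2 \<le> \<bar>Y\<bar> ^ d" using Y d by (intro power_increasing) auto
  ultimately show False by simp
qed

lemma third_iterate_fixing_map_power_imp:
  assumes "fixing_map d Y (fixing_map d Y (fixing_map d Y a)) = w ^ q" "prime q" "q dvd d"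
  shows "\<bar>a\<bar> = \<bar>Y\<bar>"
  using assms second_iterate_fixing_map_not_power abs_eq_if_fixing_map_abs_eq by blast

text \<open>The \<open>d\<close>-th power of a value of the map would have to be at most \<open>\<bar>Y\<bar> + 1\<close>, but even the value \<open>Y\<close>,
  taken at \<open>a = \<plusminus>Y\<close>, is too large for this.\<close>

lemma abs_unicritical_fixing_map_ne:
  assumes "c \<in> {0, -1}" "Y \<noteq> -1"
  shows "\<bar>unicritical_map d c (fixing_map d Y a)\<bar> \<noteq> \<bar>Y\<bar>"
proof
  assume eq: "\<bar>unicritical_map d c (fixing_map d Y a)\<bar> = \<bar>Y\<bar>"
  have "fixing_map d Y a ^ d \<ge> 0" using d by (simp add: zero_le_even_power)
  with eq assms(1) have le: "fixing_map d Y a ^ d \<le> \<bar>Y\<bar> + 1"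
    by (auto simp: unicritical_map_def)
  have Y2: "\<bar>Y\<bar> \<ge> 2" using Y assms(2) by linarith
  have "\<bar>Y\<bar> ^ 2 \<le> \<bar>Y\<bar> ^ d" using Y d by (intro power_increasing) auto
  moreover have "2 * \<bar>Y\<bar> \<le> \<bar>Y\<bar> ^ 2" using Y2 unfolding power2_eq_square by (intro mult_right_mono) auto
  ultimately have large: "\<bar>Y\<bar> + 1 < \<bar>Y\<bar> ^ d" using Y2 by linarith
  show False
  proof (cases "\<bar>a\<bar> = \<bar>Y\<bar>")
    case True
    hence "fixing_map d Y a = Y" using d by (metis unicritical_map_def power_even_abs add_diff_cancel_left' add_diff_eq)
    thus False using le large d by (simp add: power_even_abs)
  next
    case False
    note gt = square_fixing_map_gt[OF False]
    have "0 \<le> \<bar>Y\<bar> ^ d + \<bar>Y\<bar>" by simp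
    with gt have "0 < (fixing_map d Y a)\<^sup>2" by linarith
    hence "fixing_map d Y a \<noteq> 0" by auto
    hence "\<bar>fixing_map d Y a\<bar>\<^sup>2 \<le> \<bar>fixing_map d Y a\<bar> ^ d" using d by (intro power_increasing) auto
    thus False using gt le large d by (simp add: power_even_abs)
  qed
qed

end

text \<open>Write \<open>b\<close> and \<open>b'\<close> for the first two iterates of \<open>a\<close>. If the third one, \<open>b'\<^sup>d + c\<close>, is a \<open>p\<close>-th power
  up to sign, then \<open>b'\<^sup>2 \<le> \<bar>c\<bar>\<close>, where \<open>c = b' - b\<^sup>d\<close>. On the other hand \<open>b - b' = a\<^sup>d - b\<^sup>d\<close> makes \<open>b'\<close>
  much larger than \<open>b\<close>, so large that \<open>b'\<^sup>2\<close> exceeds \<open>\<bar>b' - b\<^sup>d\<bar>\<close>, except when \<open>\<bar>b\<bar> \<le> 1\<close> or \<open>\<bar>a\<bar> = \<bar>b\<bar>\<close>.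
  In the latter case \<open>b = b'\<close> is a fixed point equal to \<open>\<plusminus>Y\<close>, so \<open>c = \<plusminus>Y - Y\<^sup>d\<close>.\<close>

lemma third_iterate_abs_ne_power:
  fixes Y c y :: int
  assumes d: "d \<ge> 4" "even d" and p: "prime p" "p dvd d" and Y: "Y = y ^ p"
    and c: "c \<notin> {0, -1, Y - Y ^ d, - Y - Y ^ d}"
  shows "\<bar>unicritical_map d c (unicritical_map d c (unicritical_map d c a))\<bar> \<noteq> \<bar>Y\<bar>"
proof
  assume eq: "\<bar>unicritical_map d c (unicritical_map d c (unicritical_map d c a))\<bar> = \<bar>Y\<bar>"
  define b where "b = unicritical_map d c a"
  define b' where "b' = unicritical_map d c b"
  have b: "b = a ^ d + c" and b': "b' = b ^ d + c"
    by (simp_all add: b_def b'_def unicritical_map_def)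
  have eq: "\<bar>b' ^ d + c\<bar> = \<bar>y\<bar> ^ p"
    using eq by (simp add: b_def b'_def unicritical_map_def Y power_abs)
  have "b'\<^sup>2 \<le> \<bar>b' ^ d - (b' ^ d + c)\<bar>"
    using c by (intro power_gap_square[OF d(1) p eq]) auto
  hence le: "b'\<^sup>2 \<le> \<bar>c\<bar>" by simp
  have cb: "c = b' - b ^ d" using b' by simp
  show False
  proof (cases "\<bar>a\<bar> = \<bar>b\<bar>")
    case True
    hence "b' = b" using b b' d by (metis power_even_abs)
    hence "b' ^ d + c = b'" using b' by simp
    moreover from this have "\<bar>b'\<bar> = \<bar>Y\<bar>" using eq by (simp add: Y power_abs)
    hence "b' ^ d = Y ^ d" "b' = Y \<or> b' = - Y" using d by (metis power_even_abs, linarith)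
    ultimately show False using c by auto
  next
    case False
    define t where "t = \<bar>b\<bar>"
    have "\<bar>b\<bar> ^ (d - 1) \<le> max \<bar>a\<bar> \<bar>b\<bar> ^ (d - 1)" by (intro power_mono) auto
    also have "\<dots> \<le> \<bar>a ^ d - b ^ d\<bar>" by (rule abs_even_power_diff_ge) (use False d in auto)
    also have "a ^ d - b ^ d = b - b'" using b b' by simp
    finally have B: "t ^ (d - 1) - t \<le> \<bar>b'\<bar>" by (simp add: t_def)
    consider "t = 0" | "t = 1" | "t \<ge> 2" unfolding t_def by linarith
    thus False
    proof cases
      case 1
      hence "b = 0" by (simp add: t_def)
      hence "b' = c" using b' d by (simp add: power_0_left)
      with le have "c\<^sup>2 \<le> \<bar>c\<bar>" by simp
      hence "\<bar>c\<bar> * \<bar>c\<bar> \<le> 1 * \<bar>c\<bar>" by (simp add: power2_eq_square)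
      hence "\<bar>c\<bar> \<le> 1" using c by (subst (asm) mult_le_cancel_right) auto
      with c have "c = 1" by auto
      moreover have "a ^ d \<ge> 0" using d by (simp add: zero_le_even_power)
      ultimately show False using b \<open>b = 0\<close> by simp
    next
      case 2
      hence bb: "b = 1 \<or> b = -1" by (auto simp: t_def)
      hence "b ^ d = 1" using d by auto
      hence b'1: "b' = c + 1" using b' by simp
      have "a ^ d \<ge> 0" using d by (simp add: zero_le_even_power)
      hence "c \<le> 1" using b bb by auto
      show False
      proof (cases "c = 1")
        case True
        thus False using le b'1 by simp
      next
        \<comment> \<open>Here \<open>\<bar>a\<bar> \<ge> 2\<close>, so \<open>c = \<plusminus>1 - a\<^sup>d\<close> is large, and \<open>(c + 1)\<^sup>2\<close> exceeds \<open>\<bar>c\<bar>\<close>.\<close>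
        case c1: False
        have "a \<noteq> 0"
        proof
          assume "a = 0"
          hence "b = c" using b d by (simp add: power_0_left)
          thus False using bb c c1 by auto
        qed
        hence "\<bar>a\<bar> \<ge> 2" using False 2 by (simp add: t_def)
        hence "2 ^ d \<le> \<bar>a\<bar> ^ d" by (intro power_mono) auto
        moreover have "(2::int) ^ 4 \<le> 2 ^ d" using d by (intro power_increasing) auto
        ultimately have "a ^ d \<ge> 16" using d by (simp add: power_even_abs)
        hence cl: "c \<le> -15" using b bb by auto
        have "(c + 1)\<^sup>2 \<le> - c" using le b'1 cl by simp
        moreover have "(c + 1) * (c + 1) \<ge> (c + 1) * (-14)"
          using cl by (intro mult_left_mono_neg) auto
        ultimately show False using cl by (simp add: power2_eq_square)
      qed
    next
      case 3
      have "t ^ d + \<bar>b'\<bar> < \<bar>b'\<bar>\<^sup>2" by (rule square_growth(2)[OF 3 d(1) B])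
      moreover have "\<bar>c\<bar> \<le> \<bar>b'\<bar> + t ^ d"
        using cb by (simp add: t_def power_abs[symmetric])
      ultimately show False using le by simp
    qed
  qed
qed

text \<open>Unlike for general second iterates, the bound on the inner value \<open>c\<close> is now in terms of \<open>c\<close> itself:
  \<open>c\<^sup>2 \<le> \<bar>c\<bar>\<close>. This leaves \<open>c = 1\<close>, where the iterate is \<open>2\<close> and thus not a power.\<close>

lemma second_iterate_at_0_abs_ne_power:
  fixes Y c y :: int
  assumes d: "d \<ge> 4" "even d" and p: "prime p" "p dvd d" and Y: "Y = y ^ p"
    and c: "c \<notin> {0, -1}"
  shows "\<bar>unicritical_map d c c\<bar> \<noteq> \<bar>Y\<bar>"
proof
  assume "\<bar>unicritical_map d c c\<bar> = \<bar>Y\<bar>"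
  hence eq: "\<bar>c ^ d + c\<bar> = \<bar>y\<bar> ^ p" by (simp add: unicritical_map_def Y power_abs)
  have "c\<^sup>2 \<le> \<bar>c ^ d - (c ^ d + c)\<bar>"
    using c by (intro power_gap_square[OF d(1) p eq]) auto
  hence "\<bar>c\<bar> * \<bar>c\<bar> \<le> 1 * \<bar>c\<bar>" by (simp add: power2_eq_square)
  hence "\<bar>c\<bar> \<le> 1" using c by (subst (asm) mult_le_cancel_right) auto
  with c have "c = 1" by auto
  with eq have two: "\<bar>y\<bar> ^ p = 2" by simp
  have p2: "p \<ge> 2" using p(1) prime_ge_2_nat by blast
  show False
  proof (cases "\<bar>y\<bar> \<ge> 2")
    case True
    hence "2 ^ p \<le> \<bar>y\<bar> ^ p" by (intro power_mono) auto
    moreover have "(2::int) ^ 2 \<le> 2 ^ p" using p2 by (intro power_increasing) auto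
    ultimately show False using two by simp
  next
    case False
    hence "\<bar>y\<bar> = 0 \<or> \<bar>y\<bar> = 1" by linarith
    thus False using two p2 by (auto simp: power_0_left)
  qed
qed

section \<open>Integrality\<close>

lemma rat_root_of_int:
  fixes w :: rat
  assumes "w ^ q = of_int n" "q > 0"
  obtains v :: int where "w = of_int v"
proof -
  have "algebraic_int w"
  proof (rule algebraic_int_root)
    show "algebraic_int (of_int n :: rat)" by (rule int_imp_algebraic_int) simp
    show "poly (monom 1 q) w = of_int n" using assms(1) by (simp add: poly_monom)
  qed (use assms(2) in \<open>simp_all add: degree_monom_eq\<close>)
  moreover have "w \<in> \<rat>" using Rats_of_rat[of w, where 'a = rat] by simp
  ultimately have "w \<in> \<int>"
    by (rule rational_algebraic_int_is_int)
  thus ?thesis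
    by (rule Ints_cases) (rule that)
qed

lemma unicritical_fixed_point_int:
  fixes z :: rat
  assumes "poly (unicritical d c) z = z" "d \<ge> 2"
  obtains v :: int where "z = of_int v"
proof -
  have deg: "degree (unicritical d c - [:0, 1:]) = d"
  proof -
    have "unicritical d c - [:0, 1:] = monom 1 d + [:of_int c, -1:]"
      by (simp add: unicritical_def)
    also have "degree \<dots> = d"
      using assms(2) by (subst degree_add_eq_left) (auto simp: degree_monom_eq)
    finally show ?thesis .
  qed
  have "algebraic_int z"
  proof (rule algebraic_int_root[of 0 "unicritical d c - [:0, 1:]"])
    show "lead_coeff (unicritical d c - [:0, 1:]) = 1"
      unfolding deg using assms(2) lead_coeff_unicritical[of d c]
      by (simp add: degree_unicritical coeff_pCons split: nat.splits)
    show "\<forall>i. coeff (unicritical d c - [:0, 1:]) i \<in> \<int>"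
      by (auto simp: unicritical_def coeff_pCons split: nat.splits)
    show "poly (unicritical d c - [:0, 1:]) z = 0" using assms(1) by simp
    show "degree (unicritical d c - [:0, 1:]) > 0" using assms(2) deg by simp
  qed simp
  moreover have "z \<in> \<rat>" using Rats_of_rat[of z, where 'a = rat] by simp
  ultimately have "z \<in> \<int>"
    by (rule rational_algebraic_int_is_int)
  thus ?thesis
    by (rule Ints_cases) (rule that)
qed

lemma not_irreducible_unicritical_0:
  assumes "d \<ge> 2"
  shows "\<not> irreducible (unicritical d 0)"
proof
  assume "irreducible (unicritical d 0)"
  moreover have "unicritical d 0 = monom 1 1 * monom 1 (d - 1)"
    using assms by (simp add: unicritical_def mult_monom)
  ultimately have "is_unit (monom (1 :: rat) 1) \<or> is_unit (monom (1 :: rat) (d - 1))"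
    by (rule irreducibleD)
  thus False
    using assms by (auto simp: is_unit_iff_degree degree_monom_eq)
qed

lemma of_int_ne_power:
  assumes "\<And>v :: int. n \<noteq> v ^ q" "q > 0"
  shows "of_int n \<noteq> (w :: rat) ^ q"
proof
  assume eq: "of_int n = w ^ q"
  obtain v where "w = of_int v"
    using rat_root_of_int[OF eq[symmetric] assms(2)] by blast
  with eq assms(1)[of v] show False by (simp flip: of_int_power)
qed

section \<open>Compositions starting with a third iterate\<close>

context
  fixes d :: nat and Y :: int and P F :: "rat poly"
  defines "P \<equiv> unicritical d (Y - Y ^ d)"
    and "F \<equiv> pcompose (pcompose P P) P"
  assumes d: "d \<ge> 4" "even d" and Y: "Y \<noteq> 0" "Y \<noteq> 1" and irr: "irreducible P"
begin

lemma d_pos: "d > 0" using d(1) by simp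

lemma poly_P: "poly P (of_int a) = of_int (fixing_map d Y a)"
  by (simp add: P_def poly_unicritical_of_int)

lemma fixing_map_0: "fixing_map d Y 0 = Y - Y ^ d"
  using d by (simp add: unicritical_map_def power_0_left)

text \<open>Once \<open>F\<close> is known to be irreducible, irreducibility of the polynomials \<open>F \<circ> h\<close> is thereby reduced to
  avoiding the two integers \<open>\<plusminus>Y\<close>.\<close>

lemma poly_third_iterate_ne_power:
  assumes "\<bar>a\<bar> \<noteq> \<bar>Y\<bar>" "prime q" "q dvd d"
  shows "poly F (of_int a) \<noteq> w ^ q"
proof -
  have "of_int (fixing_map d Y (fixing_map d Y (fixing_map d Y a))) \<noteq> w ^ q"
    using third_iterate_fixing_map_power_imp[OF d Y _ assms(2,3)] assms(1) prime_gt_0_nat[OF assms(2)]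
    by (intro of_int_ne_power) blast+
  thus ?thesis by (simp add: F_def poly_pcompose poly_P)
qed

text \<open>The criterion asks for the values at the constant term \<open>Y - Y\<^sup>d\<close>, which are the values of the next
  iterate at \<open>0\<close>.\<close>

lemma even_monic_irreducible_third_iterate: "even_monic_irreducible F"
proof -
  note step = even_monic_irreducible_pcompose_unicritical[of _ d "Y - Y ^ d", folded P_def]
  have "even_monic_irreducible P"
    using d irr unfolding even_monic_irreducible_def P_def
    by (intro conjI) (assumption | rule lead_coeff_unicritical[OF d_pos] | simp only: degree_unicritical[OF d_pos])+
  hence "even_monic_irreducible (pcompose P P)"
  proof (rule step[OF _ d_pos])
    fix q and w :: rat assume "prime q" "q dvd d"
    hence "of_int (fixing_map d Y (fixing_map d Y 0)) \<noteq> w ^ q"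
      using Y prime_gt_0_nat
      by (intro of_int_ne_power second_iterate_fixing_map_not_power[OF d Y]) auto
    thus "poly P (of_int (Y - Y ^ d)) \<noteq> w ^ q"
      unfolding poly_P fixing_map_0 .
  qed
  thus ?thesis
    unfolding F_def
  proof (rule step[OF _ d_pos])
    fix q and w :: rat assume "prime q" "q dvd d"
    hence "poly F (of_int 0) \<noteq> w ^ q"
      using Y by (intro poly_third_iterate_ne_power) auto
    thus "poly (pcompose P P) (of_int (Y - Y ^ d)) \<noteq> w ^ q"
      unfolding F_def poly_pcompose[of _ P] poly_P[of 0] fixing_map_0 .
  qed
qed

lemma even_monic_irreducible_third_iterate_comp:
  assumes "\<bar>c\<bar> \<noteq> \<bar>Y\<bar>"
  shows "even_monic_irreducible (pcompose F (unicritical d c))"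
  using even_monic_irreducible_third_iterate d_pos poly_third_iterate_ne_power[OF assms]
  by (rule even_monic_irreducible_pcompose_unicritical)

text \<open>For \<open>Y = -1\<close> the excluded constants are \<open>-1\<close>, \<open>1\<close> and \<open>0\<close>; thus \<open>Y \<noteq> -1\<close> here. The polynomial that
  precedes \<open>g\<close> has no power values at integers, because the inner map never takes the values \<open>\<plusminus>Y\<close>.\<close>

lemma irreducible_third_iterate_comp_0_or_minus_1:
  assumes "c \<in> {0, -1}" "c \<notin> {Y, - Y, - Y - Y ^ d}" "g \<in> comp_semigroup (unicritical d ` C)"
  shows "irreducible (pcompose (pcompose (pcompose F (unicritical d c)) P) g)"
proof -
  have "Y \<noteq> -1" using assms(1,2) d by auto
  hence ne: "\<bar>unicritical_map d c (fixing_map d Y a)\<bar> \<noteq> \<bar>Y\<bar>" for a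
    using abs_unicritical_fixing_map_ne[OF d Y assms(1)] by blast
  have "\<bar>c\<bar> \<noteq> \<bar>Y\<bar>" using assms(2) by auto
  hence "even_monic_irreducible (pcompose F (unicritical d c))"
    by (rule even_monic_irreducible_third_iterate_comp)
  hence "even_monic_irreducible (pcompose (pcompose F (unicritical d c)) P)"
    unfolding P_def using d_pos
  proof (rule even_monic_irreducible_pcompose_unicritical)
    fix q and w :: rat assume q: "prime q" "q dvd d"
    show "poly (pcompose F (unicritical d c)) (of_int (Y - Y ^ d)) \<noteq> w ^ q"
      using poly_third_iterate_ne_power[OF ne[of 0] q]
      by (simp add: poly_pcompose poly_unicritical_of_int fixing_map_0 del: of_int_diff)
  qed
  hence "even_monic_irreducible (pcompose (pcompose (pcompose F (unicritical d c)) P) g)"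
    using even_monic_irreducible_pcompose_semigroup[OF assms(3) d_pos] poly_third_iterate_ne_power[OF ne]
    by (simp add: poly_pcompose poly_unicritical_of_int poly_P)
  thus ?thesis by (simp add: even_monic_irreducible_def)
qed

text \<open>While the third iterate of \<open>Q\<close> is being built up, the criterion asks only for the values of \<open>F\<close> at
  \<open>Q(0)\<close>, \<open>Q(Q(0))\<close> and \<open>Q(Q(Q(0)))\<close>. From then on no integer argument leads to \<open>\<plusminus>Y\<close>.\<close>

lemma irreducible_third_iterate_comp_third_iterate:
  assumes p: "prime p" "p dvd d" and Y_power: "Y = y ^ p"
    and c: "c \<notin> {0, -1}" "c \<notin> {Y, - Y, - Y - Y ^ d}" "c \<noteq> Y - Y ^ d"
    and g: "g \<in> comp_semigroup (unicritical d ` C)"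
  defines "Q \<equiv> unicritical d c"
  shows "irreducible (pcompose (pcompose (pcompose (pcompose F Q) Q) Q) g)"
proof -
  let ?V = "unicritical_map d c"
  have ne: "\<bar>?V (?V (?V a))\<bar> \<noteq> \<bar>Y\<bar>" for a
    using third_iterate_abs_ne_power[OF d p Y_power] c by auto
  have V_0: "?V 0 = c" using d by (simp add: unicritical_map_def power_0_left)
  have poly_Q: "poly Q (of_int a) = of_int (?V a)" for a
    by (simp add: Q_def poly_unicritical_of_int)
  note step = even_monic_irreducible_pcompose_unicritical[of _ d c, folded Q_def]
  have "\<bar>c\<bar> \<noteq> \<bar>Y\<bar>" using c(2) by auto
  hence "even_monic_irreducible (pcompose F Q)"
    unfolding Q_def by (rule even_monic_irreducible_third_iterate_comp)
  hence "even_monic_irreducible (pcompose (pcompose F Q) Q)"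
    using d_pos
  proof (rule step)
    fix q and w :: rat assume q: "prime q" "q dvd d"
    show "poly (pcompose F Q) (of_int c) \<noteq> w ^ q"
      using poly_third_iterate_ne_power[OF second_iterate_at_0_abs_ne_power[OF d p Y_power c(1)] q]
      by (simp add: poly_pcompose poly_Q)
  qed
  hence "even_monic_irreducible (pcompose (pcompose (pcompose F Q) Q) Q)"
    using d_pos
  proof (rule step)
    fix q and w :: rat assume q: "prime q" "q dvd d"
    show "poly (pcompose (pcompose F Q) Q) (of_int c) \<noteq> w ^ q"
      using poly_third_iterate_ne_power[OF ne[of 0] q] by (simp add: poly_pcompose poly_Q V_0)
  qed
  hence "even_monic_irreducible (pcompose (pcompose (pcompose (pcompose F Q) Q) Q) g)"
    using even_monic_irreducible_pcompose_semigroup[OF g d_pos] poly_third_iterate_ne_power[OF ne]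
    by (simp add: poly_pcompose poly_Q)
  thus ?thesis by (simp add: even_monic_irreducible_def)
qed

end

theorem proposition3p8:
  fixes d s p :: nat and c :: "nat \<Rightarrow> int" and y :: rat
    and f :: "nat \<Rightarrow> rat poly" and G :: "rat poly set"
  assumes "d \<ge> 4" and "even d" and "s \<ge> 2"
    and "inj_on c {1..s}"
    and "\<And>i. f i = unicritical d (c i)"
    and "G = comp_semigroup (f ` {1..s})"
    and "irreducible (f 1)"
    and "prime p" and "p dvd d"
    and "poly (f 1) (y ^ p) = y ^ p"
    and "of_int (c 2) \<notin> {y ^ p, - (y ^ p), - (y ^ p) - y ^ (p * d)}"
  shows "(c 2 \<in> {0, -1} \<longrightarrow>
           (\<forall>q \<in> {pcompose (comp_power (f 1) 3) (pcompose (f 2) (pcompose (f 1) g)) | g. g \<in> G}.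
              irreducible q)) \<and>
         (c 2 \<notin> {0, -1} \<longrightarrow>
           (\<forall>q \<in> {pcompose (comp_power (f 1) 3) (pcompose (comp_power (f 2) 3) g) | g. g \<in> G}.
              irreducible q))"
proof -
  have p: "p > 0" using assms(8) prime_gt_0_nat by blast
  have G: "G = comp_semigroup (unicritical d ` (c ` {1..s}))"
    using assms(5,6) by (simp add: image_image)
  obtain Y :: int where Y: "y ^ p = of_int Y"
    using unicritical_fixed_point_int[of d "c 1" "y ^ p"] assms(1,5,10) by auto
  obtain x :: int where x: "y = of_int x"
    using rat_root_of_int[OF Y p] by blast
  have Yx: "Y = x ^ p"
    using Y unfolding x by (simp flip: of_int_power)
  have "of_int (unicritical_map d (c 1) Y) = (of_int Y :: rat)"
    using assms(10) unfolding Y assms(5) poly_unicritical_of_int .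
  hence "unicritical_map d (c 1) Y = Y" by (simp only: of_int_eq_iff)
  hence c1: "c 1 = Y - Y ^ d" by (simp add: unicritical_map_def)
  have f1: "f 1 = unicritical d (Y - Y ^ d)"
    unfolding assms(5) c1 ..
  have "c 1 \<noteq> 0"
    using not_irreducible_unicritical_0[of d] assms(1,5,7) by auto
  hence Y01: "Y \<noteq> 0" "Y \<noteq> 1" using c1 assms(1) by auto
  have "(of_int (c 2) :: rat) \<notin> of_int ` {Y, - Y, - Y - Y ^ d}"
    using assms(11) by (simp add: power_mult Y)
  hence c2: "c 2 \<notin> {Y, - Y, - Y - Y ^ d}" by blast
  have c12: "c 2 \<noteq> Y - Y ^ d"
    using inj_onD[OF assms(4), of 1 2] assms(3) unfolding c1[symmetric] by auto
  have comp_power_3: "comp_power X 3 = pcompose (pcompose X X) X" for X :: "rat poly"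
    by (simp add: comp_power_def numeral_3_eq_3 pcompose_assoc)
  have "irreducible (pcompose (comp_power (f 1) 3) (pcompose (f 2) (pcompose (f 1) g)))"
    if "c 2 \<in> {0, -1}" "g \<in> G" for g
    using irreducible_third_iterate_comp_0_or_minus_1[OF assms(1,2) Y01 _ that(1) c2, of g] that(2) assms(7)
    unfolding G comp_power_3 pcompose_assoc f1 assms(5)[of 2] by blast
  moreover have "irreducible (pcompose (comp_power (f 1) 3) (pcompose (comp_power (f 2) 3) g))"
    if "c 2 \<notin> {0, -1}" "g \<in> G" for g
    using irreducible_third_iterate_comp_third_iterate[OF assms(1,2) Y01 _ assms(8,9) Yx that(1) c2 c12, of g]
      that(2) assms(7)
    unfolding G comp_power_3 pcompose_assoc f1 assms(5)[of 2] by blast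
  ultimately show ?thesis by blast
qed

end
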